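(* Let $\alpha,\beta,\gamma\in[0,1]$ and let $p$ be the probability that a candidate accepts an offer. The optimal strategy for the best choice problem with uncertain employment and the penalties is to accept (that is, to make the proposal to) the relatively best applicant, until the chosen one accepts the proposal, starting from the moment $$t^\star(\alpha,\beta,\gamma,p)=\Big(\frac{p\alpha+\beta-(1-p)\gamma}{\alpha+\beta}\Big)^{\frac1{1-p}} .$$
   Context: Best choice problem with uncertain employment and penalties: $N$ distinct rankable applicants appear one by one in uniformly random order, and only relative ranks are observed. An applicant is relatively best (a candidate) if better than all previous ones. When a candidate appears the decision maker either makes a proposal or passes, without recall. A proposal is accepted with probability $p$ and refused with probability $1-p$; after a refusal the search continues. The payoff is $\alpha$ if the hired applicant is the best of all $N$, $-\beta$ if the hired applicant is not the best, and $-\gamma$ if nobody is hired; the aim is to maximize the expected payoff. The moment $t^\star$ is expressed in the asymptotic time scale in which the $k$-th of $N$ applicants appears at time $t=k/N$, with $N\to\infty$.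
   Formalization: When the fraction is negative (e.g. α=0.1, β=0, γ=1, p=1/2) the displayed power is undefined or gives a wrong moment; there the optimal moment is taken to be 0. The cases α+β=0 and p=1, where the formula is undefined, are excluded. *)

theory Defs
  imports "HOL-Probability.Probability" "HOL-Combinatorics.Permutations"
begin

text \<open>
  The applicants appear in the order \<open>1, \<dots>, N\<close>; \<open>\<pi> k\<close> is the absolute rank of the
  \<open>k\<close>-th applicant among all \<open>N\<close> (rank \<open>1\<close> is the best), and \<open>\<omega> k\<close> says whether the
  \<open>k\<close>-th applicant would accept a proposal.
\<close>

definition rel_rank :: "(nat \<Rightarrow> nat) \<Rightarrow> nat \<Rightarrow> nat" where
  "rel_rank \<pi> k = card {j \<in> {1..k}. \<pi> j \<le> \<pi> k}"

definition candidate :: "(nat \<Rightarrow> nat) \<Rightarrow> nat \<Rightarrow> bool" where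
  "candidate \<pi> k \<longleftrightarrow> (\<forall>j\<in>{1..<k}. \<pi> k < \<pi> j)"

text \<open>
  A strategy maps the list of relative ranks observed so far to the decision whether to
  propose to the current applicant; it is consulted only when that applicant is a candidate.
  Earlier responses are not an argument: while the search is still going on, every earlier
  proposal was refused, so the responses seen are determined by the ranks and the strategy.
\<close>

type_synonym strategy = "nat list \<Rightarrow> bool"

definition proposes :: "strategy \<Rightarrow> (nat \<Rightarrow> nat) \<Rightarrow> nat \<Rightarrow> bool" where
  "proposes \<sigma> \<pi> k \<longleftrightarrow> candidate \<pi> k \<and> \<sigma> (map (rel_rank \<pi>) [1..<Suc k])"

definition hires :: "strategy \<Rightarrow> (nat \<Rightarrow> nat) \<Rightarrow> (nat \<Rightarrow> bool) \<Rightarrow> nat \<Rightarrow> bool" where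
  "hires \<sigma> \<pi> \<omega> k \<longleftrightarrow>
     proposes \<sigma> \<pi> k \<and> \<omega> k \<and> (\<forall>j\<in>{1..<k}. \<not> (proposes \<sigma> \<pi> j \<and> \<omega> j))"

definition payoff ::
  "real \<Rightarrow> real \<Rightarrow> real \<Rightarrow> nat \<Rightarrow> strategy \<Rightarrow> (nat \<Rightarrow> nat) \<Rightarrow> (nat \<Rightarrow> bool) \<Rightarrow> real" where
  "payoff \<alpha> \<beta> \<gamma> N \<sigma> \<pi> \<omega> =
     (if \<exists>k\<in>{1..N}. hires \<sigma> \<pi> \<omega> k \<and> \<pi> k = 1 then \<alpha>
      else if \<exists>k\<in>{1..N}. hires \<sigma> \<pi> \<omega> k then - \<beta>
      else - \<gamma>)"

definition scenario_pmf :: "real \<Rightarrow> nat \<Rightarrow> ((nat \<Rightarrow> nat) \<times> (nat \<Rightarrow> bool)) pmf" where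
  "scenario_pmf p N =
     pair_pmf (pmf_of_set {\<pi>. \<pi> permutes {1..N}}) (Pi_pmf {1..N} False (\<lambda>_. bernoulli_pmf p))"

definition expected_payoff ::
  "real \<Rightarrow> real \<Rightarrow> real \<Rightarrow> real \<Rightarrow> nat \<Rightarrow> strategy \<Rightarrow> real" where
  "expected_payoff \<alpha> \<beta> \<gamma> p N \<sigma> =
     measure_pmf.expectation (scenario_pmf p N) (\<lambda>(\<pi>, \<omega>). payoff \<alpha> \<beta> \<gamma> N \<sigma> \<pi> \<omega>)"

definition optimal_strategy ::
  "real \<Rightarrow> real \<Rightarrow> real \<Rightarrow> real \<Rightarrow> nat \<Rightarrow> strategy \<Rightarrow> bool" where
  "optimal_strategy \<alpha> \<beta> \<gamma> p N \<sigma> \<longleftrightarrow>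
     (\<forall>\<sigma>'. expected_payoff \<alpha> \<beta> \<gamma> p N \<sigma>' \<le> expected_payoff \<alpha> \<beta> \<gamma> p N \<sigma>)"

definition optimal_value :: "real \<Rightarrow> real \<Rightarrow> real \<Rightarrow> real \<Rightarrow> nat \<Rightarrow> real" where
  "optimal_value \<alpha> \<beta> \<gamma> p N = (SUP \<sigma>. expected_payoff \<alpha> \<beta> \<gamma> p N \<sigma>)"

text \<open>
  Propose to every candidate from the moment \<open>t\<close> on, where the \<open>k\<close>-th of \<open>N\<close> applicants
  appears at the moment \<open>k / N\<close> (the list of relative ranks then has length \<open>k\<close>).
\<close>

definition start_from :: "nat \<Rightarrow> real \<Rightarrow> strategy" where
  "start_from N t = (\<lambda>h. t \<le> real (length h) / real N)"

text \<open>
  The fraction is at most \<open>1\<close> but can be negative (for instance if \<open>\<beta> = 0\<close> and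
  \<open>p * \<alpha> < (1 - p) * \<gamma>\<close>), and then its real power is undefined. In that case proposals
  should be made from the very beginning, which the truncation by \<open>max 0\<close> encodes as the
  moment \<open>0\<close>.
\<close>

definition t_star :: "real \<Rightarrow> real \<Rightarrow> real \<Rightarrow> real \<Rightarrow> real" where
  "t_star \<alpha> \<beta> \<gamma> p =
     (max 0 ((p * \<alpha> + \<beta> - (1 - p) * \<gamma>) / (\<alpha> + \<beta>))) powr (1 / (1 - p))"

end

theory Submission
  imports Defs "HOL-Real_Asymp.Real_Asymp"
begin

text \<open>
  The relative ranks of a uniformly random permutation are independent and uniform, so the \<open>k\<close>-th
  applicant is a candidate with probability \<open>1 / k\<close> whatever the history, and a candidate at \<open>k\<close> is
  the best of all with probability \<open>k / N\<close>. Hence the value \<open>V k\<close> of continuing after \<open>k\<close> depends on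
  \<open>k\<close> only and does not increase, whereas the payoff of hiring a candidate increases: a threshold rule
  is optimal. The value of proposing to every candidate after \<open>m\<close> is explicit,
  \<open>- \<beta> - p * A * m / N + C * h m / h N\<close> where \<open>h m = fact m / pochhammer (1 - p) m\<close> grows like
  \<open>m powr p\<close>, \<open>A = (\<alpha> + \<beta>) / (1 - p)\<close> and \<open>C = \<beta> - \<gamma> + p * A\<close>, so an optimal threshold is where
  \<open>A * h N / N - C * h k / k\<close> changes sign; in the limit this reads \<open>t powr (1 - p) = C / A\<close>.
\<close>

subsection \<open>Relative ranks of a random permutation\<close>

lemma candidate_iff_rel_rank:
  assumes "1 \<le> k"
  shows "candidate \<pi> k \<longleftrightarrow> rel_rank \<pi> k = 1"
proof -
  have "{j \<in> {1..k}. \<pi> j \<le> \<pi> k} = insert k {j \<in> {1..<k}. \<pi> j \<le> \<pi> k}"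
    using assms by (auto simp: le_less)
  then have "rel_rank \<pi> k = Suc (card {j \<in> {1..<k}. \<pi> j \<le> \<pi> k})"
    by (simp add: rel_rank_def)
  then show ?thesis
    by (auto simp: candidate_def not_le)
qed

text \<open>The position of rank \<open>1\<close> is itself a candidate and admits none after it.
  Being best of all, which the history up to \<open>k\<close> does not determine, is thereby
  expressed through candidacy alone.\<close>

lemma best_iff_last_candidate:
  assumes \<pi>: "\<pi> permutes {1..N}" and k: "k \<in> {1..N}"
  shows "\<pi> k = 1 \<longleftrightarrow> candidate \<pi> k \<and> (\<forall>j\<in>{k<..N}. \<not> candidate \<pi> j)"
proof
  have inj: "\<pi> i = \<pi> j \<Longrightarrow> i = j" for i j
    using permutes_inj[OF \<pi>] by (simp add: inj_eq)
  have pos: "1 \<le> \<pi> j" if "j \<in> {1..N}" for j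
    using permutes_in_image[OF \<pi>, of j] that by simp
  { assume 1: "\<pi> k = 1"
    have "\<pi> k < \<pi> j" if "j \<in> {1..N}" "j \<noteq> k" for j
      using pos[OF that(1)] inj[of j k] that(2) 1 by force
    then have less: "\<pi> k < \<pi> j" if "j \<in> {1..N}" "j \<noteq> k" for j using that by blast
    have "candidate \<pi> k"
      using k less by (auto simp: candidate_def)
    moreover have "\<not> candidate \<pi> j" if "j \<in> {k<..N}" for j
    proof
      assume "candidate \<pi> j"
      then have "\<pi> j < \<pi> k" using that k by (auto simp: candidate_def)
      then show False using less[of j] that k by auto
    qed
    ultimately show "candidate \<pi> k \<and> (\<forall>j\<in>{k<..N}. \<not> candidate \<pi> j)" by blast }
  assume R: "candidate \<pi> k \<and> (\<forall>j\<in>{k<..N}. \<not> candidate \<pi> j)"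
  obtain m where m: "m \<in> {1..N}" "\<pi> m = 1"
    using permutes_image[OF \<pi>] k by (metis atLeastAtMost_iff imageE le_trans order_refl)
  have "\<pi> m < \<pi> j" if "j \<in> {1..N}" "j \<noteq> m" for j
    using pos[OF that(1)] inj[of j m] that(2) m by force
  then have "candidate \<pi> m"
    using m by (force simp: candidate_def)
  then have "m \<le> k"
    using R m by (meson atLeastAtMost_iff greaterThanAtMost_iff not_le)
  moreover have "\<not> m < k"
  proof
    assume "m < k"
    then have "\<pi> k < \<pi> m" using R m(1) unfolding candidate_def by (meson atLeastAtMost_iff atLeastLessThan_iff)
    then show False using pos[OF k] m by simp
  qed
  ultimately show "\<pi> k = 1" using m by simp
qed

text \<open>The order is recovered from the last applicant backwards: once the values after
  \<open>k\<close> are known, so is the set of values on \<open>{1..k}\<close>, and the relative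
  rank of \<open>k\<close> singles out \<open>\<pi> k\<close> in it.\<close>

lemma rel_rank_determines_permutation:
  assumes \<pi>: "\<pi> permutes {1..N}" and \<pi>': "\<pi>' permutes {1..N}"
    and eq: "\<And>k. k \<in> {1..N} \<Longrightarrow> rel_rank \<pi> k = rel_rank \<pi>' k"
  shows "\<pi> = \<pi>'"
proof -
  have tail: "m \<le> N \<Longrightarrow> \<forall>i\<in>{N - m<..N}. \<pi> i = \<pi>' i" for m
  proof (induction m)
    case (Suc m)
    define k where "k = N - m"
    have k: "k \<in> {1..N}" "N - Suc m = k - 1" using Suc.prems by (auto simp: k_def)
    have IH: "\<forall>i\<in>{k<..N}. \<pi> i = \<pi>' i" using Suc k_def by simp
    have image: "\<rho> ` {1..k} = {1..N} - \<rho> ` {k<..N}" if "\<rho> permutes {1..N}" for \<rho>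
    proof -
      have "{1..k} = {1..N} - {k<..N}" using k by auto
      then show ?thesis
        using permutes_image[OF that] image_set_diff[OF permutes_inj[OF that]] by metis
    qed
    have rank: "rel_rank \<rho> k = card {a \<in> \<rho> ` {1..k}. a \<le> \<rho> k}" if "\<rho> permutes {1..N}" for \<rho>
    proof -
      have "{a \<in> \<rho> ` {1..k}. a \<le> \<rho> k} = \<rho> ` {j \<in> {1..k}. \<rho> j \<le> \<rho> k}" by auto
      then show ?thesis
        unfolding rel_rank_def
        using card_image[OF inj_on_subset[OF permutes_inj[OF that] subset_UNIV]] by metis
    qed
    define A where "A = \<pi> ` {1..k}"
    have A: "A = \<pi>' ` {1..k}"
      using image[OF \<pi>] image[OF \<pi>'] IH unfolding A_def by auto
    have fin: "finite A" by (simp add: A_def)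
    have mem: "\<pi> k \<in> A" "\<pi>' k \<in> A"
      using k(1) by (simp add: A_def) (use k(1) in \<open>simp add: A\<close>)
    have cards: "card {a \<in> A. a \<le> \<pi> k} = card {a \<in> A. a \<le> \<pi>' k}"
      using rank[OF \<pi>] rank[OF \<pi>'] eq[OF k(1)] A A_def by simp
    \<comment> \<open>Counting the elements of \<open>A\<close> up to a point is strictly increasing
      at points of \<open>A\<close>, so equal counts force equal values.\<close>
    have less: "card {a \<in> A. a \<le> x} < card {a \<in> A. a \<le> y}" if "y \<in> A" "x < y" for x y
    proof (rule psubset_card_mono)
      have "y \<notin> {a \<in> A. a \<le> x}" "y \<in> {a \<in> A. a \<le> y}" using that by auto
      then show "{a \<in> A. a \<le> x} \<subset> {a \<in> A. a \<le> y}" using that(2) by force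
    qed (use fin in auto)
    have "\<pi> k = \<pi>' k"
      using less[OF mem(1), of "\<pi>' k"] less[OF mem(2), of "\<pi> k"] cards
      by (metis less_irrefl linorder_less_linear)
    moreover have "{N - Suc m<..N} = insert k {k<..N}" using k by auto
    ultimately show ?case using IH by simp
  qed simp
  show ?thesis
  proof
    fix i
    show "\<pi> i = \<pi>' i"
    proof (cases "i \<in> {1..N}")
      case True
      then show ?thesis using tail[of N] by auto
    next
      case False
      then show ?thesis using \<pi> \<pi>' by (simp add: permutes_not_in)
    qed
  qed
qed

text \<open>Injectivity together with \<open>fact N\<close> elements on both sides. As the target is
  a full product, the relative ranks are independent and the \<open>k\<close>-th is uniform on
  \<open>{1..k}\<close>.\<close>

lemma bij_betw_rel_rank:
  "bij_betw (\<lambda>\<pi>. restrict (rel_rank \<pi>) {1..N}) {\<pi>. \<pi> permutes {1..N}} (PiE {1..N} (\<lambda>k. {1..k}))"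
proof -
  have inj: "inj_on (\<lambda>\<pi>. restrict (rel_rank \<pi>) {1..N}) {\<pi>. \<pi> permutes {1..N}}"
    by (intro inj_onI, rule rel_rank_determines_permutation) (auto, metis restrict_apply' atLeastAtMost_iff One_nat_def)
  have range: "rel_rank \<pi> k \<in> {1..k}" if "k \<in> {1..N}" for \<pi> k
  proof -
    have "rel_rank \<pi> k \<le> card {1..k}" unfolding rel_rank_def by (rule card_mono) auto
    moreover have "k \<in> {j \<in> {1..k}. \<pi> j \<le> \<pi> k}" using that by simp
    then have "rel_rank \<pi> k \<noteq> 0" unfolding rel_rank_def by (subst card_0_eq) auto
    ultimately show ?thesis by simp
  qed
  have "card (PiE {1..N} (\<lambda>k. {1..k})) = fact N"
    by (simp add: card_PiE fact_prod)
  moreover have "card {\<pi>. \<pi> permutes {1..N}} = fact N"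
    by (rule card_permutations) auto
  moreover have "(\<lambda>\<pi>. restrict (rel_rank \<pi>) {1..N}) ` {\<pi>. \<pi> permutes {1..N}} \<subseteq> PiE {1..N} (\<lambda>k. {1..k})"
    using range by auto
  moreover have "finite (PiE {1..N} (\<lambda>k::nat. {1..k}))" by (rule finite_PiE) auto
  ultimately show ?thesis
    using inj by (metis bij_betw_def card_image card_subset_eq)
qed

lemma sum_PiE_split_coordinate:
  assumes "finite A" "k \<in> A" "\<And>i. i \<in> A \<Longrightarrow> finite (B i)"
  shows "(\<Sum>r\<in>PiE A B. f r) = (\<Sum>x\<in>B k. \<Sum>r\<in>PiE (A - {k}) B. f (r(k := x)))"
proof -
  have A: "insert k (A - {k}) = A" using assms by auto
  have "PiE A B = (\<lambda>(x, r). r(k := x)) ` (B k \<times> PiE (A - {k}) B)"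
    using PiE_insert_eq[of k "A - {k}" B] A by simp
  moreover have "inj_on (\<lambda>(x, r). r(k := x)) (B k \<times> PiE (A - {k}) B)"
    using inj_combinator[of k "A - {k}" B] by simp
  ultimately show ?thesis
    by (simp add: sum.reindex sum.cartesian_product case_prod_unfold)
qed

text \<open>On the product of relative ranks, \<open>f\<close> ignores coordinate \<open>k\<close>,
  and just one of the \<open>k\<close> values of that coordinate makes a candidate.\<close>

lemma sum_permutations_candidate:
  fixes f :: "nat list \<Rightarrow> real"
  assumes k: "k \<in> {1..N}"
  shows "(\<Sum>\<pi> | \<pi> permutes {1..N}. f (map (rel_rank \<pi>) [1..<k]) * of_bool (candidate \<pi> k))
       = (\<Sum>\<pi> | \<pi> permutes {1..N}. f (map (rel_rank \<pi>) [1..<k])) / real k"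
proof -
  let ?B = "\<lambda>k::nat. {1..k}"
  let ?R = "PiE {1..N} ?B"
  have split: "(\<Sum>r\<in>?R. g r) = (\<Sum>x\<in>{1..k}. \<Sum>r\<in>PiE ({1..N} - {k}) ?B. g (r(k := x)))"
    for g :: "(nat \<Rightarrow> nat) \<Rightarrow> real"
    by (rule sum_PiE_split_coordinate) (use k in auto)
  have hist: "map (r(k := x)) [1..<k] = map r [1..<k]" for r :: "nat \<Rightarrow> nat" and x
    by (intro map_cong) auto
  have hist': "map (restrict r {1..N}) [1..<k] = map r [1..<k]" for r :: "nat \<Rightarrow> nat"
    using k by (intro map_cong) auto
  have transfer: "(\<Sum>\<pi> | \<pi> permutes {1..N}. g (restrict (rel_rank \<pi>) {1..N})) = (\<Sum>r\<in>?R. g r)"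
    for g :: "(nat \<Rightarrow> nat) \<Rightarrow> real"
    by (rule sum.reindex_bij_betw[OF bij_betw_rel_rank])
  have "(\<Sum>\<pi> | \<pi> permutes {1..N}. f (map (rel_rank \<pi>) [1..<k]) * of_bool (candidate \<pi> k))
      = (\<Sum>r\<in>?R. f (map r [1..<k]) * of_bool (r k = 1))"
    using k by (subst transfer[symmetric]) (simp add: hist' candidate_iff_rel_rank flip: One_nat_def)
  also have "\<dots> = (\<Sum>r\<in>PiE ({1..N} - {k}) ?B. f (map r [1..<k]))"
  proof -
    have "(\<Sum>x\<in>{1..k}. c * of_bool (x = 1)) = c" for c :: real
    proof -
      have "{1..k} \<inter> {1} = {1}" using k by auto
      then show ?thesis by simp
    qed
    then show ?thesis
      unfolding split hist by (subst sum.swap) (simp only: fun_upd_same)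
  qed
  also have "\<dots> = (\<Sum>r\<in>?R. f (map r [1..<k])) / real k"
    using k unfolding split hist by simp
  also have "\<dots> = (\<Sum>\<pi> | \<pi> permutes {1..N}. f (map (rel_rank \<pi>) [1..<k])) / real k"
    by (subst transfer[symmetric]) (simp add: hist' flip: One_nat_def)
  finally show ?thesis .
qed

text \<open>Whatever the history, no further candidate appears up to \<open>m\<close> with
  probability \<open>k / m\<close>, the telescoping product of \<open>(j - 1) / j\<close> over
  \<open>k < j \<le> m\<close>; at \<open>m = N\<close> this is the event of being the best.\<close>

lemma sum_permutations_best:
  fixes f :: "nat list \<Rightarrow> real"
  assumes k: "k \<in> {1..N}"
  shows "(\<Sum>\<pi> | \<pi> permutes {1..N}.
            f (map (rel_rank \<pi>) [1..<Suc k]) * of_bool (candidate \<pi> k) * of_bool (\<pi> k = 1))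
       = real k / real N *
         (\<Sum>\<pi> | \<pi> permutes {1..N}. f (map (rel_rank \<pi>) [1..<Suc k]) * of_bool (candidate \<pi> k))"
proof -
  let ?P = "{\<pi>. \<pi> permutes {1..N}}"
  let ?h = "\<lambda>\<pi>. map (rel_rank \<pi>) [1..<Suc k]"
  have "m \<in> {k..N} \<Longrightarrow> (\<Sum>\<pi>\<in>?P. f (?h \<pi>) * of_bool (candidate \<pi> k) * of_bool (\<forall>j\<in>{k<..m}. \<not> candidate \<pi> j))
        = real k / real m * (\<Sum>\<pi>\<in>?P. f (?h \<pi>) * of_bool (candidate \<pi> k))" for m
  proof (induction m)
    case 0
    then show ?case using k by simp
  next
    case (Suc m)
    show ?case
    proof (cases "k = Suc m")
      case True
      then show ?thesis using k by simp
    next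
      case False
      then have m: "m \<in> {k..N}" "Suc m \<in> {1..N}" using Suc.prems by auto
      \<comment> \<open>The event up to \<open>m\<close> is packed into a function of the history of
        length \<open>m\<close>, so that independence applies to applicant \<open>Suc m\<close>.
        Lists count from \<open>0\<close>, whence \<open>j - 1\<close>.\<close>
      define F where "F h = f (take k h) * of_bool (h ! (k - 1) = 1) *
        of_bool (\<forall>j\<in>{k<..m}. h ! (j - 1) \<noteq> 1)" for h :: "nat list"
      have F: "F (map (rel_rank \<pi>) [1..<Suc m])
        = f (?h \<pi>) * of_bool (candidate \<pi> k) * of_bool (\<forall>j\<in>{k<..m}. \<not> candidate \<pi> j)" for \<pi>
      proof -
        have "take k (map (rel_rank \<pi>) [1..<Suc m]) = ?h \<pi>"
          using m by (simp add: take_map take_upt del: upt_Suc)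
        moreover have "map (rel_rank \<pi>) [1..<Suc m] ! (j - 1) = rel_rank \<pi> j" if "j \<in> {1..m}" for j
          using that by (subst nth_map) (auto simp del: upt_Suc)
        ultimately show ?thesis
          using m k unfolding F_def by (auto simp: candidate_iff_rel_rank simp del: upt_Suc)
      qed
      have "{k<..Suc m} = insert (Suc m) {k<..m}" using m by auto
      then have "(\<Sum>\<pi>\<in>?P. f (?h \<pi>) * of_bool (candidate \<pi> k) * of_bool (\<forall>j\<in>{k<..Suc m}. \<not> candidate \<pi> j))
        = (\<Sum>\<pi>\<in>?P. F (map (rel_rank \<pi>) [1..<Suc m]))
          - (\<Sum>\<pi>\<in>?P. F (map (rel_rank \<pi>) [1..<Suc m]) * of_bool (candidate \<pi> (Suc m)))"
        unfolding F by (auto simp: sum_subtractf[symmetric] intro!: sum.cong)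
      also have "\<dots> = (\<Sum>\<pi>\<in>?P. F (map (rel_rank \<pi>) [1..<Suc m])) * (real m / real (Suc m))"
        unfolding sum_permutations_candidate[OF m(2)] by (simp add: field_simps)
      also have "\<dots> = real k / real (Suc m) * (\<Sum>\<pi>\<in>?P. f (?h \<pi>) * of_bool (candidate \<pi> k))"
        unfolding F using Suc.IH[OF m(1)] m k by (simp add: field_simps)
      finally show ?thesis .
    qed
  qed
  from this[of N] k have "(\<Sum>\<pi>\<in>?P. f (?h \<pi>) * of_bool (candidate \<pi> k) * of_bool (\<forall>j\<in>{k<..N}. \<not> candidate \<pi> j))
        = real k / real N * (\<Sum>\<pi>\<in>?P. f (?h \<pi>) * of_bool (candidate \<pi> k))" by simp
  moreover have "f (?h \<pi>) * of_bool (candidate \<pi> k) * of_bool (\<pi> k = 1)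
     = f (?h \<pi>) * of_bool (candidate \<pi> k) * of_bool (\<forall>j\<in>{k<..N}. \<not> candidate \<pi> j)" if "\<pi> \<in> ?P" for \<pi>
    using best_iff_last_candidate[of \<pi> N k] that k by auto
  then have "(\<Sum>\<pi>\<in>?P. f (?h \<pi>) * of_bool (candidate \<pi> k) * of_bool (\<pi> k = 1))
     = (\<Sum>\<pi>\<in>?P. f (?h \<pi>) * of_bool (candidate \<pi> k) * of_bool (\<forall>j\<in>{k<..N}. \<not> candidate \<pi> j))"
    by (rule sum.cong[OF refl])
  ultimately show ?thesis by (simp only:)
qed

subsection \<open>Expected payoff of a strategy\<close>

text \<open>The conditional probability, given the order \<open>\<pi>\<close>, that nobody has been hired among the first \<open>k\<close>.\<close>

definition survival :: "real \<Rightarrow> strategy \<Rightarrow> (nat \<Rightarrow> nat) \<Rightarrow> nat \<Rightarrow> real" where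
  "survival p \<sigma> \<pi> k = (\<Prod>j\<in>{1..k}. 1 - p * of_bool (proposes \<sigma> \<pi> j))"

lemma survival_rec:
  "1 \<le> k \<Longrightarrow> survival p \<sigma> \<pi> k = survival p \<sigma> \<pi> (k - 1) * (1 - p * of_bool (proposes \<sigma> \<pi> k))"
  by (cases k) (simp_all add: survival_def)

lemma survival_nonneg: "p \<le> 1 \<Longrightarrow> 0 \<le> survival p \<sigma> \<pi> k"
  unfolding survival_def by (intro prod_nonneg) auto

text \<open>At most one applicant is hired, so at most one summand survives. The payoff becomes
  linear in the hiring indicators.\<close>

lemma payoff_eq_sum:
  "payoff \<alpha> \<beta> \<gamma> N \<sigma> \<pi> \<omega> =
     - \<gamma> + (\<Sum>k\<in>{1..N}. of_bool (hires \<sigma> \<pi> \<omega> k) * (\<gamma> - \<beta> + (\<alpha> + \<beta>) * of_bool (\<pi> k = 1)))"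
proof (cases "\<exists>k\<in>{1..N}. hires \<sigma> \<pi> \<omega> k")
  case True
  then obtain k where k: "k \<in> {1..N}" "hires \<sigma> \<pi> \<omega> k" by blast
  have unique: "hires \<sigma> \<pi> \<omega> j \<longleftrightarrow> j = k" if "j \<in> {1..N}" for j
    using k that unfolding hires_def by (metis atLeastAtMost_iff atLeastLessThan_iff linorder_neqE_nat)
  have "(\<Sum>j\<in>{1..N}. of_bool (hires \<sigma> \<pi> \<omega> j) * (\<gamma> - \<beta> + (\<alpha> + \<beta>) * of_bool (\<pi> j = 1)))
      = (\<Sum>j\<in>{1..N}. if j = k then \<gamma> - \<beta> + (\<alpha> + \<beta>) * of_bool (\<pi> k = 1) else 0)"
    by (rule sum.cong) (auto simp: unique)
  also have "\<dots> = \<gamma> - \<beta> + (\<alpha> + \<beta>) * of_bool (\<pi> k = 1)" using k by simp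
  finally show ?thesis
    using k unique by (auto simp: payoff_def)
next
  case False
  then show ?thesis by (auto simp: payoff_def)
qed

text \<open>For a fixed order the indicator is a product of functions of single responses
  \<open>\<omega> j\<close>, which are independent; responses after \<open>k\<close> contribute the
  factor \<open>1\<close>.\<close>

lemma expectation_hires:
  assumes p: "0 \<le> p" "p \<le> 1" and k: "k \<in> {1..N}"
  shows "measure_pmf.expectation (Pi_pmf {1..N} False (\<lambda>_. bernoulli_pmf p))
           (\<lambda>\<omega>. of_bool (hires \<sigma> \<pi> \<omega> k) :: real)
         = survival p \<sigma> \<pi> (k - 1) * p * of_bool (proposes \<sigma> \<pi> k)"
proof -
  let ?q = "\<lambda>j. of_bool (proposes \<sigma> \<pi> j) :: real"
  define f where "f j b = (if j < k then 1 - ?q j * of_bool b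
      else if j = k then ?q j * of_bool b else 1)" for j b
  have split: "(\<Prod>j\<in>{1..N}. h j) = (\<Prod>j\<in>{1..k - 1}. h j) * h k"
    if "\<And>j. j > k \<Longrightarrow> h j = 1" for h :: "nat \<Rightarrow> real"
  proof -
    have "(\<Prod>j\<in>{1..N}. h j) = (\<Prod>j\<in>{1..k}. h j)"
      by (rule prod.mono_neutral_right) (use k that in auto)
    moreover have "{1..k} = insert k {1..k - 1}" "k \<notin> {1..k - 1}" using k by auto
    ultimately show ?thesis by (simp add: mult.commute)
  qed
  have "of_bool (hires \<sigma> \<pi> \<omega> k) = (\<Prod>j\<in>{1..N}. f j (\<omega> j))" for \<omega>
  proof -
    have "(\<Prod>j\<in>{1..N}. f j (\<omega> j)) = (\<Prod>j\<in>{1..k - 1}. of_bool (\<not> (proposes \<sigma> \<pi> j \<and> \<omega> j))) * (?q k * of_bool (\<omega> k))"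
      by (subst split) (auto simp: f_def intro!: arg_cong2[where f = "(*)"] prod.cong)
    also have "(\<Prod>j\<in>{1..k - 1}. of_bool (\<not> (proposes \<sigma> \<pi> j \<and> \<omega> j)) :: real)
        = of_bool (\<forall>j\<in>{1..k - 1}. \<not> (proposes \<sigma> \<pi> j \<and> \<omega> j))"
      by (cases "\<forall>j\<in>{1..k - 1}. \<not> (proposes \<sigma> \<pi> j \<and> \<omega> j)") (auto intro!: prod_zero)
    also have "{1..k - 1} = {1..<k}" using k by auto
    finally show ?thesis by (auto simp: hires_def)
  qed
  then have "measure_pmf.expectation (Pi_pmf {1..N} False (\<lambda>_. bernoulli_pmf p))
           (\<lambda>\<omega>. of_bool (hires \<sigma> \<pi> \<omega> k) :: real)
       = (\<Prod>j\<in>{1..N}. measure_pmf.expectation (bernoulli_pmf p) (f j))"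
    by (simp only:, subst expectation_prod_Pi_pmf)
      (auto intro!: integrable_measure_pmf_finite simp: f_def)
  also have "\<dots> = (\<Prod>j\<in>{1..k - 1}. measure_pmf.expectation (bernoulli_pmf p) (f j))
      * measure_pmf.expectation (bernoulli_pmf p) (f k)"
    by (rule split) (use p in \<open>simp add: f_def\<close>)
  also have "\<dots> = (\<Prod>j\<in>{1..k - 1}. 1 - p * ?q j) * (p * ?q k)"
    using p k by (intro arg_cong2[where f = "(*)"] prod.cong) (auto simp: f_def algebra_simps)
  finally show ?thesis by (simp add: survival_def)
qed

text \<open>The average of \<open>survival\<close> over all orders, hence the unconditional
  probability that the search is still open after \<open>k\<close>; the responses are already
  integrated out.\<close>

definition searching_prob :: "real \<Rightarrow> nat \<Rightarrow> strategy \<Rightarrow> nat \<Rightarrow> real" where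
  "searching_prob p N \<sigma> k = (\<Sum>\<pi> | \<pi> permutes {1..N}. survival p \<sigma> \<pi> k) / fact N"

definition propose_prob :: "real \<Rightarrow> nat \<Rightarrow> strategy \<Rightarrow> nat \<Rightarrow> real" where
  "propose_prob p N \<sigma> k =
     (\<Sum>\<pi> | \<pi> permutes {1..N}. survival p \<sigma> \<pi> (k - 1) * of_bool (proposes \<sigma> \<pi> k)) / fact N"

lemma card_permutes: "card {\<pi>. \<pi> permutes {1..N}} = fact N"
  by (rule card_permutations) auto

lemma searching_prob_0: "searching_prob p N \<sigma> 0 = 1"
  by (simp add: searching_prob_def survival_def card_permutes del: One_nat_def)

lemma searching_prob_rec:
  "1 \<le> k \<Longrightarrow> searching_prob p N \<sigma> k = searching_prob p N \<sigma> (k - 1) - p * propose_prob p N \<sigma> k"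
  unfolding searching_prob_def propose_prob_def
  by (simp add: survival_rec[of k] sum_subtractf sum_distrib_left diff_divide_distrib right_diff_distrib mult_ac)

text \<open>\<open>survival\<close> as a function of the observed list, the form in which it can be
  summed over permutations by independence.\<close>

definition history_survival :: "real \<Rightarrow> strategy \<Rightarrow> nat list \<Rightarrow> real" where
  "history_survival p \<sigma> h = (\<Prod>j\<in>{1..length h}. 1 - p * of_bool (h ! (j - 1) = 1 \<and> \<sigma> (take j h)))"

lemma survival_eq_history_survival:
  "survival p \<sigma> \<pi> k = history_survival p \<sigma> (map (rel_rank \<pi>) [1..<Suc k])"
  unfolding survival_def history_survival_def
proof (rule prod.cong)
  fix j assume "j \<in> {1..length (map (rel_rank \<pi>) [1..<Suc k])}"
  then have j: "1 \<le> j" "j \<le> k" by (auto simp del: upt_Suc)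
  have "take j (map (rel_rank \<pi>) [1..<Suc k]) = map (rel_rank \<pi>) [1..<Suc j]"
    using j by (simp add: take_map take_upt del: upt_Suc)
  moreover have "map (rel_rank \<pi>) [1..<Suc k] ! (j - 1) = rel_rank \<pi> j"
    using j by (subst nth_map) (auto simp del: upt_Suc)
  ultimately show "1 - p * of_bool (proposes \<sigma> \<pi> j) = 1 - p * of_bool (map (rel_rank \<pi>) [1..<Suc k] ! (j - 1) = 1 \<and>
      \<sigma> (take j (map (rel_rank \<pi>) [1..<Suc k])))"
    using j by (simp add: proposes_def candidate_iff_rel_rank del: upt_Suc)
qed simp

lemma sum_survival_candidate:
  assumes "k \<in> {1..N}"
  shows "(\<Sum>\<pi> | \<pi> permutes {1..N}. survival p \<sigma> \<pi> (k - 1) * of_bool (candidate \<pi> k)) / fact N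
       = searching_prob p N \<sigma> (k - 1) / real k"
proof -
  have "Suc (k - 1) = k" using assms by simp
  then show ?thesis
    using sum_permutations_candidate[OF assms, of "history_survival p \<sigma>"]
    unfolding searching_prob_def survival_eq_history_survival by simp
qed

lemma propose_prob_nonneg: "p \<le> 1 \<Longrightarrow> 0 \<le> propose_prob p N \<sigma> k"
  unfolding propose_prob_def by (intro divide_nonneg_nonneg sum_nonneg mult_nonneg_nonneg survival_nonneg) auto

text \<open>The bound is the probability that a candidate appears at \<open>k\<close> while the
  search is open; a strategy can only skip some of these cases.\<close>

lemma propose_prob_le:
  assumes "p \<le> 1" "k \<in> {1..N}"
  shows "propose_prob p N \<sigma> k \<le> searching_prob p N \<sigma> (k - 1) / real k"
  unfolding propose_prob_def sum_survival_candidate[OF assms(2), symmetric]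
  using assms(1)
  by (intro divide_right_mono sum_mono mult_left_mono survival_nonneg) (auto simp: proposes_def)

text \<open>The assumption speaks of nonempty lists only, since a decision at
  \<open>k \<ge> 1\<close> sees \<open>k\<close> ranks. The moment \<open>0\<close> accepts the
  empty list too, which no \<open>k0 \<ge> 1\<close> does.\<close>

lemma propose_prob_threshold:
  assumes \<sigma>: "\<And>h. h \<noteq> [] \<Longrightarrow> \<sigma> h \<longleftrightarrow> k0 \<le> length h" and k: "k \<in> {1..N}"
  shows "propose_prob p N \<sigma> k = of_bool (k0 \<le> k) * (searching_prob p N \<sigma> (k - 1) / real k)"
proof -
  have "proposes \<sigma> \<pi> k \<longleftrightarrow> k0 \<le> k \<and> candidate \<pi> k" for \<pi>
    using k by (subst proposes_def, subst \<sigma>) auto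
  then show ?thesis
    unfolding propose_prob_def sum_survival_candidate[OF k, symmetric] by simp
qed

text \<open>By linearity the strategy enters only through \<open>propose_prob\<close>, and the
  indicator of \<open>\<pi> k = 1\<close> is replaced by its conditional probability
  \<open>k / N\<close>.\<close>

lemma expected_payoff_eq:
  assumes p: "0 \<le> p" "p \<le> 1"
  shows "expected_payoff \<alpha> \<beta> \<gamma> p N \<sigma> =
    - \<gamma> + (\<Sum>k\<in>{1..N}. p * (\<gamma> + ((\<alpha> + \<beta>) * (real k / real N) - \<beta>)) * propose_prob p N \<sigma> k)"
proof -
  let ?P = "{\<pi>. \<pi> permutes {1..N}}"
  let ?\<Omega> = "Pi_pmf {1..N} False (\<lambda>_. bernoulli_pmf p)"
  have finP: "finite ?P" by (rule finite_permutations) simp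
  have neP: "?P \<noteq> {}" using permutes_id by blast
  have fin\<Omega>: "finite (set_pmf ?\<Omega>)"
    by (rule finite_subset[OF set_Pi_pmf_subset']) (auto intro!: finite_PiE_dflt)
  have int: "integrable ?\<Omega> f" for f :: "(nat \<Rightarrow> bool) \<Rightarrow> real"
    using fin\<Omega> by (rule integrable_measure_pmf_finite)
  have "scenario_pmf p N = pmf_of_set ?P \<bind> (\<lambda>\<pi>. map_pmf (Pair \<pi>) ?\<Omega>)"
    by (simp add: scenario_pmf_def pair_pmf_def map_pmf_def)
  then have "expected_payoff \<alpha> \<beta> \<gamma> p N \<sigma>
      = (\<Sum>\<pi>\<in>?P. measure_pmf.expectation ?\<Omega> (\<lambda>\<omega>. payoff \<alpha> \<beta> \<gamma> N \<sigma> \<pi> \<omega>)) / fact N"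
    unfolding expected_payoff_def
    using finP neP fin\<Omega>
    by (simp add: pmf_expectation_bind_pmf_of_set card_permutes sum_divide_distrib field_simps del: One_nat_def)
  also have "\<dots> = (\<Sum>\<pi>\<in>?P. - \<gamma> + (\<Sum>k\<in>{1..N}. (survival p \<sigma> \<pi> (k - 1) * p * of_bool (proposes \<sigma> \<pi> k))
      * (\<gamma> - \<beta> + (\<alpha> + \<beta>) * of_bool (\<pi> k = 1)))) / fact N"
  proof (intro arg_cong2[where f = "(/)"] sum.cong refl)
    fix \<pi>
    show "measure_pmf.expectation ?\<Omega> (\<lambda>\<omega>. payoff \<alpha> \<beta> \<gamma> N \<sigma> \<pi> \<omega>)
      = - \<gamma> + (\<Sum>k\<in>{1..N}. (survival p \<sigma> \<pi> (k - 1) * p * of_bool (proposes \<sigma> \<pi> k))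
        * (\<gamma> - \<beta> + (\<alpha> + \<beta>) * of_bool (\<pi> k = 1)))"
      unfolding payoff_eq_sum
      by (simp add: int del: One_nat_def sum_of_bool_mult_eq)
        (intro sum.cong refl, simp add: expectation_hires[OF p] del: One_nat_def)
  qed
  also have "\<dots> = - \<gamma> + (\<Sum>k\<in>{1..N}. \<Sum>\<pi>\<in>?P. (survival p \<sigma> \<pi> (k - 1) * p * of_bool (proposes \<sigma> \<pi> k))
      * (\<gamma> - \<beta> + (\<alpha> + \<beta>) * of_bool (\<pi> k = 1))) / fact N"
    by (simp only: sum.distrib sum_constant card_permutes add_divide_distrib sum.swap[of _ ?P]) simp
  also have "(\<Sum>k\<in>{1..N}. \<Sum>\<pi>\<in>?P. (survival p \<sigma> \<pi> (k - 1) * p * of_bool (proposes \<sigma> \<pi> k))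
      * (\<gamma> - \<beta> + (\<alpha> + \<beta>) * of_bool (\<pi> k = 1))) / fact N
     = (\<Sum>k\<in>{1..N}. p * (\<gamma> + ((\<alpha> + \<beta>) * (real k / real N) - \<beta>)) * propose_prob p N \<sigma> k)"
    unfolding sum_divide_distrib[of _ "{1..N}"]
  proof (rule sum.cong)
    fix k assume k: "k \<in> {1..N}"
    define w where "w \<pi> = survival p \<sigma> \<pi> (k - 1) * of_bool (proposes \<sigma> \<pi> k)" for \<pi>
    \<comment> \<open>The weight has to be a function of the history times \<open>candidate\<close>:
      survival involves the first \<open>k - 1\<close> ranks, the decision all
      \<open>k\<close>.\<close>
    define f where "f h = history_survival p \<sigma> (take (k - 1) h) * of_bool (\<sigma> h)" for h
    have w: "w \<pi> = f (map (rel_rank \<pi>) [1..<Suc k]) * of_bool (candidate \<pi> k)" for \<pi>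
    proof -
      have "take (k - 1) (map (rel_rank \<pi>) [1..<Suc k]) = map (rel_rank \<pi>) [1..<Suc (k - 1)]"
        using k by (simp add: take_map take_upt del: upt_Suc)
      then show ?thesis
        by (auto simp: w_def f_def survival_eq_history_survival proposes_def simp del: upt_Suc)
    qed
    have best: "(\<Sum>\<pi>\<in>?P. w \<pi> * of_bool (\<pi> k = 1)) = real k / real N * (\<Sum>\<pi>\<in>?P. w \<pi>)"
      unfolding w by (rule sum_permutations_best[OF k])
    have "(\<Sum>\<pi>\<in>?P. (survival p \<sigma> \<pi> (k - 1) * p * of_bool (proposes \<sigma> \<pi> k))
        * (\<gamma> - \<beta> + (\<alpha> + \<beta>) * of_bool (\<pi> k = 1)))
      = p * (\<gamma> - \<beta>) * (\<Sum>\<pi>\<in>?P. w \<pi>) + p * (\<alpha> + \<beta>) * (\<Sum>\<pi>\<in>?P. w \<pi> * of_bool (\<pi> k = 1))"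
      unfolding sum_distrib_left sum.distrib[symmetric]
      by (rule sum.cong) (auto simp: w_def algebra_simps)
    also have "\<dots> = p * (\<gamma> + ((\<alpha> + \<beta>) * (real k / real N) - \<beta>)) * (\<Sum>\<pi>\<in>?P. w \<pi>)"
      unfolding best by (simp add: algebra_simps)
    finally show "(\<Sum>\<pi>\<in>?P. (survival p \<sigma> \<pi> (k - 1) * p * of_bool (proposes \<sigma> \<pi> k))
        * (\<gamma> - \<beta> + (\<alpha> + \<beta>) * of_bool (\<pi> k = 1))) / fact N
      = p * (\<gamma> + ((\<alpha> + \<beta>) * (real k / real N) - \<beta>)) * propose_prob p N \<sigma> k"
      by (simp add: propose_prob_def w_def)
  qed simp
  finally show ?thesis .
qed

subsection \<open>Asymptotics of the factorial quotient\<close>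

text \<open>Up to a factor, the solution of \<open>h (k - 1) = (1 - p / k) * h k\<close>, the homogeneous part of the
  recursion for the value of proposing to every candidate.\<close>

definition refusal_growth :: "real \<Rightarrow> nat \<Rightarrow> real" where
  "refusal_growth p n = fact n / pochhammer (1 - p) n"

lemma refusal_growth_pos: "p < 1 \<Longrightarrow> 0 < refusal_growth p n"
  by (simp add: refusal_growth_def pochhammer_pos)

lemma refusal_growth_Suc:
  assumes "p < 1"
  shows "refusal_growth p (Suc n) * (real (Suc n) - p) = real (Suc n) * refusal_growth p n"
proof -
  have "pochhammer (1 - p) n > 0" "1 - p + real n > 0" using assms by (auto intro: pochhammer_pos)
  moreover have "real (Suc n) - p = 1 - p + real n" by simp
  ultimately show ?thesis
    unfolding refusal_growth_def pochhammer_Suc by (simp add: divide_simps)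
qed

text \<open>Euler's limit for the Gamma function: \<open>Gamma_series (1 - p) n\<close> differs from
  the claimed quotient by the factor \<open>(1 - p + n) / n\<close>, which tends to
  \<open>1\<close>.\<close>

lemma refusal_growth_asymp:
  assumes "p < 1"
  shows "(\<lambda>n. refusal_growth p n / real n powr p) \<longlonglongrightarrow> Gamma (1 - p)"
proof -
  have eq: "Gamma_series (1 - p) n * ((1 - p + real n) / real n) = refusal_growth p n / real n powr p"
    if "n > 0" for n
  proof -
    have "exp ((1 - p) * ln (real n)) = real n / real n powr p"
      using that by (simp add: powr_def exp_diff left_diff_distrib)
    moreover have "pochhammer (1 - p) n > 0" "1 - p + real n > 0"
      using assms by (auto intro: pochhammer_pos)
    ultimately show ?thesis
      using that by (simp add: Gamma_series_def refusal_growth_def pochhammer_Suc)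
  qed
  have "(\<lambda>n. (1 - p + real n) / real n) \<longlonglongrightarrow> 1" by real_asymp
  then have "(\<lambda>n. Gamma_series (1 - p) n * ((1 - p + real n) / real n)) \<longlonglongrightarrow> Gamma (1 - p) * 1"
    by (intro tendsto_mult Gamma_series_LIMSEQ)
  then show ?thesis
    using eq by (subst tendsto_cong[where g = "\<lambda>n. Gamma_series (1 - p) n * ((1 - p + real n) / real n)"])
      (auto intro!: eventually_sequentiallyI[of 1])
qed

text \<open>Comparing this sequence at \<open>k\<close> and at \<open>N\<close> decides the sign of
  \<open>margin\<close>; it decays like \<open>n powr (p - 1)\<close>.\<close>

definition refusal_ratio :: "real \<Rightarrow> nat \<Rightarrow> real" where
  "refusal_ratio p n = refusal_growth p n / real n"

lemma refusal_ratio_pos: "p < 1 \<Longrightarrow> 0 < n \<Longrightarrow> 0 < refusal_ratio p n"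
  by (simp add: refusal_ratio_def refusal_growth_pos)

lemma refusal_ratio_Suc:
  assumes "p < 1" "0 < n"
  shows "refusal_ratio p (Suc n) = refusal_ratio p n * (real n / (real (Suc n) - p))"
proof -
  have "real (Suc n) - p > 0" using assms by simp
  then show ?thesis
    using refusal_growth_Suc[OF assms(1), of n] assms by (simp add: refusal_ratio_def field_simps)
qed

lemma refusal_ratio_antimono:
  assumes "p < 1" "0 < m" "m \<le> n"
  shows "refusal_ratio p n \<le> refusal_ratio p m"
  using assms(3)
proof (induction n rule: dec_induct)
  case (step i)
  have "real i / (real (Suc i) - p) \<le> 1" using assms step by simp
  moreover have "0 < refusal_ratio p i" using assms step by (simp add: refusal_ratio_pos)
  ultimately have "refusal_ratio p (Suc i) \<le> refusal_ratio p i"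
    using assms step by (simp only: refusal_ratio_Suc mult_left_le less_imp_le)
  then show ?case using step by simp
qed simp

lemma refusal_ratio_asymp:
  assumes "p < 1"
  shows "(\<lambda>n. refusal_ratio p n * real n powr (1 - p)) \<longlonglongrightarrow> Gamma (1 - p)"
proof -
  have "\<forall>\<^sub>F n in sequentially. refusal_ratio p n * real n powr (1 - p) = refusal_growth p n / real n powr p"
    by (rule eventually_sequentiallyI[of 1]) (simp add: refusal_ratio_def powr_diff)
  then show ?thesis using refusal_growth_asymp[OF assms] by (simp add: tendsto_cong)
qed

lemma refusal_ratio_tendsto_0:
  assumes "p < 1"
  shows "refusal_ratio p \<longlonglongrightarrow> 0"
proof -
  have "(\<lambda>n. real n powr (p - 1)) \<longlonglongrightarrow> 0"
    using tendsto_neg_powr[of "p - 1" "\<lambda>n. real n" sequentially] assms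
    by (simp add: filterlim_real_sequentially)
  from tendsto_mult[OF refusal_ratio_asymp[OF assms] this]
  have "(\<lambda>n. refusal_ratio p n * real n powr (1 - p) * real n powr (p - 1)) \<longlonglongrightarrow> 0" by simp
  moreover have "\<forall>\<^sub>F n in sequentially.
      refusal_ratio p n * real n powr (1 - p) * real n powr (p - 1) = refusal_ratio p n"
    by (rule eventually_sequentiallyI[of 1]) (simp flip: powr_add add: mult.assoc)
  ultimately show ?thesis by (simp add: tendsto_cong)
qed

text \<open>Both growths are asymptotic to \<open>Gamma (1 - p)\<close> times a \<open>p\<close>-th
  power, so the constant cancels.\<close>

lemma refusal_growth_quotient_tendsto:
  assumes p: "p < 1" and t: "0 < t" and m: "(\<lambda>N. real (m N) / real N) \<longlonglongrightarrow> t"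
  shows "(\<lambda>N. refusal_growth p (m N) / refusal_growth p N) \<longlonglongrightarrow> t powr p"
proof -
  define a where "a n = refusal_growth p n / real n powr p" for n
  have G: "Gamma (1 - p) \<noteq> 0" using Gamma_real_pos[of "1 - p"] p by (simp add: less_imp_neq[symmetric])
  have a: "a \<longlonglongrightarrow> Gamma (1 - p)" unfolding a_def using refusal_growth_asymp[OF p] .
  \<comment> \<open>Positivity of \<open>t\<close> forces \<open>m N\<close> to infinity, so that
    the asymptotics may be used along \<open>m\<close>.\<close>
  have "filterlim (\<lambda>N. real (m N) / real N * real N) at_top sequentially"
    by (rule filterlim_tendsto_pos_mult_at_top[OF m t filterlim_real_sequentially])
  moreover have "\<forall>\<^sub>F N in sequentially. real (m N) / real N * real N = real (m N)"
    by (rule eventually_sequentiallyI[of 1]) simp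
  ultimately have "filterlim (\<lambda>N. real (m N)) at_top sequentially"
    by (simp add: filterlim_cong)
  then have mtop: "filterlim m sequentially sequentially"
    by (simp add: filterlim_sequentially_iff_filterlim_real)
  have "(\<lambda>N. a (m N) / a N * (real (m N) / real N) powr p) \<longlonglongrightarrow> Gamma (1 - p) / Gamma (1 - p) * t powr p"
    using a G t by (intro tendsto_mult tendsto_divide tendsto_powr m tendsto_const filterlim_compose[OF a mtop]) auto
  moreover have "\<forall>\<^sub>F N in sequentially.
      a (m N) / a N * (real (m N) / real N) powr p = refusal_growth p (m N) / refusal_growth p N"
    using eventually_ge_at_top[of 1] filterlim_at_top[THEN iffD1, OF mtop, rule_format, of 1]
    by eventually_elim (simp add: a_def powr_divide)
  ultimately show ?thesis using G by (simp add: tendsto_cong)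
qed

text \<open>The inequalities at \<open>k N\<close> and \<open>k N - 1\<close> squeeze
  \<open>refusal_ratio p N / refusal_ratio p (k N)\<close> to \<open>x\<close>, and by the power
  asymptotics this quotient behaves like \<open>(k N / N) powr (1 - p)\<close>.\<close>

lemma threshold_asymp:
  assumes p: "p < 1" and x: "0 < x"
    and k: "\<And>N. 1 \<le> N \<Longrightarrow> 1 \<le> k N"
    and upper: "\<And>N. 1 \<le> N \<Longrightarrow> x * refusal_ratio p (k N) \<le> refusal_ratio p N"
    and lower: "\<And>N. 1 \<le> N \<Longrightarrow> 2 \<le> k N \<Longrightarrow> refusal_ratio p N \<le> x * refusal_ratio p (k N - 1)"
  shows "(\<lambda>N. real (k N) / real N) \<longlonglongrightarrow> x powr (1 / (1 - p))"
proof -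
  let ?r = "refusal_ratio p"
  \<comment> \<open>A bounded \<open>k N\<close> would keep \<open>x * ?r (k N)\<close> away from
    \<open>0\<close>, whereas its upper bound \<open>?r N\<close> tends to \<open>0\<close>.\<close>
  have ktop: "filterlim k sequentially sequentially"
    unfolding filterlim_at_top
  proof
    fix K
    have "0 < x * ?r (Suc K)" using x p by (simp add: refusal_ratio_pos)
    from order_tendstoD(2)[OF refusal_ratio_tendsto_0[OF p] this] eventually_ge_at_top[of 1]
    show "\<forall>\<^sub>F N in sequentially. K \<le> k N"
    proof eventually_elim
      case (elim N)
      then have "x * ?r (k N) < x * ?r (Suc K)" using upper[of N] by simp
      then have "?r (k N) < ?r (Suc K)" using x by simp
      then have "\<not> k N \<le> Suc K"
        using refusal_ratio_antimono[OF p, of "k N" "Suc K"] k[of N] elim by force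
      then show ?case by simp
    qed
  qed
  have k2: "\<forall>\<^sub>F N in sequentially. 2 \<le> k N \<and> 1 \<le> N"
    using filterlim_at_top[THEN iffD1, OF ktop, rule_format, of 2] eventually_ge_at_top[of 1]
    by eventually_elim simp
  have step: "?r (k N - 1) / ?r (k N) = (real (k N) - p) / (real (k N) - 1)" if "2 \<le> k N" for N
  proof -
    have "real (k N) - p > 0" "real (k N) - 1 > 0" "?r (k N - 1) > 0" "?r (k N) > 0"
      using that p by (auto intro: refusal_ratio_pos)
    then show ?thesis
      using refusal_ratio_Suc[OF p, of "k N - 1"] that by (simp add: field_simps)
  qed
  have "(\<lambda>n. (real n - p) / (real n - 1)) \<longlonglongrightarrow> 1" by real_asymp
  from filterlim_compose[OF this ktop]
  have "(\<lambda>N. x * ((real (k N) - p) / (real (k N) - 1))) \<longlonglongrightarrow> x * 1"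
    by (rule tendsto_mult_left)
  then have lim: "(\<lambda>N. x * ((real (k N) - p) / (real (k N) - 1))) \<longlonglongrightarrow> x" by simp
  have ratio: "(\<lambda>N. ?r N / ?r (k N)) \<longlonglongrightarrow> x"
  proof (rule real_tendsto_sandwich[OF _ _ tendsto_const lim])
    show "\<forall>\<^sub>F N in sequentially. x \<le> ?r N / ?r (k N)"
      using k2 by eventually_elim (use upper p in \<open>simp add: pos_le_divide_eq refusal_ratio_pos\<close>)
    show "\<forall>\<^sub>F N in sequentially. ?r N / ?r (k N) \<le> x * ((real (k N) - p) / (real (k N) - 1))"
      using k2
    proof eventually_elim
      case (elim N)
      have "?r (k N) > 0" using elim p by (simp add: refusal_ratio_pos)
      then have "?r N / ?r (k N) \<le> x * ?r (k N - 1) / ?r (k N)"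
        using lower[of N] elim by (intro divide_right_mono) auto
      also have "\<dots> = x * ((real (k N) - p) / (real (k N) - 1))"
        using step[of N] elim by (simp only: times_divide_eq_right[symmetric])
      finally show ?case .
    qed
  qed
  define b where "b n = ?r n * real n powr (1 - p)" for n
  have G: "Gamma (1 - p) \<noteq> 0" using Gamma_real_pos[of "1 - p"] p by (simp add: less_imp_neq[symmetric])
  have b: "b \<longlonglongrightarrow> Gamma (1 - p)" unfolding b_def using refusal_ratio_asymp[OF p] .
  \<comment> \<open>The correction \<open>b (k N) / b N\<close> tends to \<open>1\<close> and turns
    the quotient into the exact power \<open>(k N / N) powr (1 - p)\<close>.\<close>
  have "(\<lambda>N. (?r N / ?r (k N) * (b (k N) / b N)) powr (1 / (1 - p)))
      \<longlonglongrightarrow> (x * (Gamma (1 - p) / Gamma (1 - p))) powr (1 / (1 - p))"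
    using G x by (intro tendsto_powr tendsto_mult tendsto_divide ratio b filterlim_compose[OF b ktop] tendsto_const) auto
  moreover have "\<forall>\<^sub>F N in sequentially.
      (?r N / ?r (k N) * (b (k N) / b N)) powr (1 / (1 - p)) = real (k N) / real N"
    using k2
  proof eventually_elim
    case (elim N)
    have "?r N > 0" "?r (k N) > 0" using elim p by (auto intro: refusal_ratio_pos)
    then have "?r N / ?r (k N) * (b (k N) / b N) = (real (k N) / real N) powr (1 - p)"
      by (simp add: b_def powr_divide)
    then show ?case using p elim by (simp add: powr_powr)
  qed
  ultimately show ?thesis using G by (simp add: tendsto_cong)
qed

subsection \<open>Threshold strategies\<close>

text \<open>Summation by parts of \<open>V k * M k\<close>: for any \<open>V\<close> with the right terminal value, the payoff is \<open>V 0\<close>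
  plus the accumulated one-step defects of \<open>V\<close> in the dynamic programming equation.\<close>

lemma verification:
  fixes M Q V g :: "nat \<Rightarrow> real"
  assumes M0: "M 0 = 1" and M: "\<And>k. k \<in> {1..N} \<Longrightarrow> M k = M (k - 1) - p * Q k" and V: "V N = - \<gamma>"
  shows "- \<gamma> + (\<Sum>k\<in>{1..N}. p * (\<gamma> + g k) * Q k)
    = V 0 + (\<Sum>k\<in>{1..N}. (V k - V (k - 1)) * M (k - 1) + p * (g k - V k) * Q k)"
proof -
  have tele: "(\<Sum>k\<in>{1..N}. f k - f (k - 1)) = f N - f 0" for f :: "nat \<Rightarrow> real"
    by (induction N) auto
  have "(\<Sum>k\<in>{1..N}. (V k - V (k - 1)) * M (k - 1) + p * (g k - V k) * Q k)
      - (\<Sum>k\<in>{1..N}. p * (\<gamma> + g k) * Q k)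
      = (\<Sum>k\<in>{1..N}. (V k + \<gamma>) * M k - (V (k - 1) + \<gamma>) * M (k - 1))
        - \<gamma> * (\<Sum>k\<in>{1..N}. M k - M (k - 1))
        + (\<Sum>k\<in>{1..N}. \<gamma> * (M k - M (k - 1)))"
    unfolding sum_distrib_left sum_subtractf[symmetric] sum.distrib[symmetric]
    by (rule sum.cong) (simp_all add: M algebra_simps)
  also have "\<dots> = - V 0 - \<gamma>"
    using tele[of "\<lambda>k. (V k + \<gamma>) * M k"] V M0 by (simp add: sum_distrib_left)
  finally show ?thesis by simp
qed

section \<open>The value of threshold rules and the sign of the margin\<close>

locale uncertain_employment =
  fixes \<alpha> \<beta> \<gamma> p :: real
  assumes bounds: "0 \<le> \<alpha>" "0 \<le> \<beta>" "0 \<le> \<gamma>" "0 < \<alpha> + \<beta>" "0 \<le> p" "p < 1"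
begin

text \<open>The slope in \<open>k / N\<close> of the linear part of
  \<open>offer N k - threshold_value N k\<close>.\<close>

definition A :: real where "A = (\<alpha> + \<beta>) / (1 - p)"

text \<open>Chosen so that the value at \<open>N\<close> is \<open>- \<gamma>\<close>.\<close>

definition C :: real where "C = \<beta> - \<gamma> + p * A"

text \<open>
  \<open>threshold_value N m\<close> is the expected payoff after \<open>m\<close> applicants, none of them hired, if proposals
  are made to all later candidates. It is the solution of \<open>V (k - 1) = V k + p / k * (offer N k - V k)\<close>,
  \<open>V N = - \<gamma>\<close>.
\<close>

definition threshold_value :: "nat \<Rightarrow> nat \<Rightarrow> real" where
  "threshold_value N m =
     - \<beta> - p * A * (real m / real N) + C * (refusal_growth p m / refusal_growth p N)"

abbreviation "F \<equiv> threshold_value"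

text \<open>The expected payoff of hiring a candidate at \<open>k\<close>, who is the best of all with probability \<open>k / N\<close>.\<close>

definition offer :: "nat \<Rightarrow> nat \<Rightarrow> real" where
  "offer N k = (\<alpha> + \<beta>) * (real k / real N) - \<beta>"

text \<open>Has the sign of \<open>offer N k - threshold_value N k\<close>.\<close>

definition margin :: "nat \<Rightarrow> nat \<Rightarrow> real" where
  "margin N k = A * refusal_ratio p N - C * refusal_ratio p k"

lemma A_pos: "0 < A" using bounds by (simp add: A_def)

lemma A_eq: "A = (\<alpha> + \<beta>) + p * A"
  using bounds by (simp add: A_def field_simps)

lemma A_minus_C: "A - C = \<alpha> + \<gamma>"
  using A_eq by (simp add: C_def)

lemma threshold_value_N:
  assumes "1 \<le> N" shows "F N N = - \<gamma>"
proof -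
  have "refusal_growth p N > 0" using bounds refusal_growth_pos by simp
  then show ?thesis using assms by (simp add: threshold_value_def C_def)
qed

lemma offer_minus_value:
  assumes "1 \<le> k" "1 \<le> N"
  shows "offer N k - F N k = real k / (real N * refusal_ratio p N) * margin N k"
proof -
  have *: "refusal_growth p N > 0" "refusal_growth p k > 0" using bounds refusal_growth_pos by auto
  have "offer N k - F N k = ((\<alpha> + \<beta>) + p * A) * (real k / real N)
      - C * (refusal_growth p k / refusal_growth p N)"
    unfolding offer_def threshold_value_def distrib_right by linarith
  also have "(\<alpha> + \<beta>) + p * A = A" by (rule A_eq[symmetric])
  also have "A * (real k / real N) - C * (refusal_growth p k / refusal_growth p N)
      = real k / (real N * refusal_ratio p N) * margin N k"
    using * assms unfolding margin_def refusal_ratio_def by (simp add: field_simps)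
  finally show ?thesis .
qed

text \<open>The terms \<open>- \<beta> - p * A * (k / N)\<close> are a particular solution, and
  \<open>refusal_growth\<close> solves the homogeneous recursion.\<close>

lemma threshold_value_rec:
  assumes "1 \<le> k" "1 \<le> N"
  shows "F N (k - 1) - F N k = p / real k * (offer N k - F N k)"
proof -
  obtain m where m: "k = Suc m" using assms by (cases k) auto
  have pos: "refusal_growth p N > 0" using bounds refusal_growth_pos by auto
  define h where "h = refusal_growth p k / refusal_growth p N"
  have "refusal_growth p (k - 1) = (1 - p / real k) * refusal_growth p k"
    using refusal_growth_Suc[of p m] bounds m by (simp add: field_simps)
  then have m1: "refusal_growth p (k - 1) / refusal_growth p N = (1 - p / real k) * h"
    by (simp add: h_def)
  have m2: "real (k - 1) / real N = real k / real N - 1 / real N"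
    using m by (simp add: diff_divide_distrib[symmetric])
  have "F N (k - 1) - F N k = p * A / real N - C * (p / real k) * h"
    unfolding threshold_value_def m1 m2 h_def[symmetric] by (simp add: algebra_simps)
  also have "A = (\<alpha> + \<beta>) + p * A" by (rule A_eq)
  also have "p * ((\<alpha> + \<beta>) + p * A) / real N - C * (p / real k) * h = p / real k * (offer N k - F N k)"
    using assms unfolding offer_def threshold_value_def h_def[symmetric] by (simp add: field_simps)
  finally show ?thesis .
qed

lemma threshold_value_step:
  assumes "1 \<le> k" "1 \<le> N"
  shows "F N (k - 1) - F N k = p / (real N * refusal_ratio p N) * margin N k"
  unfolding threshold_value_rec[OF assms] offer_minus_value[OF assms] using assms by simp

text \<open>Weak inequalities on both sides admit ties, so that for \<open>0 < p\<close> these are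
  exactly the optimal thresholds. At \<open>k = 1\<close> no lower condition is asked:
  \<open>refusal_ratio p 0\<close> is \<open>0\<close> by division by zero, so
  \<open>margin N 0\<close> is positive.\<close>

definition crossing :: "nat \<Rightarrow> nat \<Rightarrow> bool" where
  "crossing N k \<longleftrightarrow> k \<in> {1..N} \<and> 0 \<le> margin N k \<and> (2 \<le> k \<longrightarrow> margin N (k - 1) \<le> 0)"

text \<open>A candidate at \<open>N\<close> is certainly the best and pays \<open>\<alpha>\<close>,
  which is not below the \<open>- \<gamma>\<close> of hiring nobody.\<close>

lemma margin_N_nonneg:
  assumes "1 \<le> N" shows "0 \<le> margin N N"
proof -
  have "margin N N = (\<alpha> + \<gamma>) * refusal_ratio p N"
    unfolding A_minus_C[symmetric] by (simp add: margin_def algebra_simps)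
  then show ?thesis using assms bounds refusal_ratio_pos[of p N] by simp
qed

lemma crossing_exists:
  assumes "1 \<le> N" shows "\<exists>k. crossing N k"
proof -
  define k where "k = (LEAST k. 1 \<le> k \<and> 0 \<le> margin N k)"
  have N: "1 \<le> N \<and> 0 \<le> margin N N" using assms margin_N_nonneg by simp
  have k: "1 \<le> k \<and> 0 \<le> margin N k" unfolding k_def by (rule LeastI[of _ N]) (rule N)
  have "k \<le> N" unfolding k_def by (rule Least_le) (rule N)
  moreover have "margin N (k - 1) \<le> 0" if "2 \<le> k"
    using not_less_Least[of "k - 1" "\<lambda>k. 1 \<le> k \<and> 0 \<le> margin N k"] that
    unfolding k_def[symmetric] by auto
  ultimately show ?thesis using k by (auto simp: crossing_def)
qed

text \<open>For \<open>C \<ge> 0\<close> the margin grows because \<open>refusal_ratio\<close>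
  decreases; for \<open>C < 0\<close> the monotonicity is reversed, but both terms are
  nonnegative.\<close>

lemma margin_nonneg_mono:
  assumes "1 \<le> j" "j \<le> k" "1 \<le> N" "0 \<le> margin N j"
  shows "0 \<le> margin N k"
proof (cases "0 \<le> C")
  case True
  have "C * refusal_ratio p k \<le> C * refusal_ratio p j"
    using assms bounds refusal_ratio_antimono[of p j k] True by (intro mult_left_mono) auto
  then show ?thesis using assms(4) by (simp add: margin_def)
next
  case False
  have "0 \<le> A * refusal_ratio p N"
    using A_pos refusal_ratio_pos[of p N] assms bounds by (intro mult_nonneg_nonneg) auto
  moreover have "C * refusal_ratio p k \<le> 0"
    using False refusal_ratio_pos[of p k] assms bounds by (intro mult_nonpos_nonneg) auto
  ultimately show ?thesis by (simp add: margin_def)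
qed

text \<open>With \<open>V\<close> frozen at \<open>F N (k - 1)\<close> before \<open>k\<close>,
  every one-step defect vanishes: earlier nothing is proposed, and later the recursion for
  \<open>F\<close> applies since every candidate gets a proposal.\<close>

lemma expected_payoff_threshold:
  assumes k: "k \<in> {1..N}" and \<sigma>: "\<And>h. h \<noteq> [] \<Longrightarrow> \<sigma> h \<longleftrightarrow> k \<le> length h"
  shows "expected_payoff \<alpha> \<beta> \<gamma> p N \<sigma> = F N (k - 1)"
proof -
  have N: "1 \<le> N" using k by simp
  define V where "V j = F N (max j (k - 1))" for j
  have "expected_payoff \<alpha> \<beta> \<gamma> p N \<sigma> = V 0 + (\<Sum>j\<in>{1..N}. (V j - V (j - 1)) * searching_prob p N \<sigma> (j - 1)
      + p * (offer N j - V j) * propose_prob p N \<sigma> j)"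
    unfolding expected_payoff_eq[OF bounds(5) less_imp_le[OF bounds(6)]] offer_def
    by (rule verification) (use k N in \<open>auto simp: searching_prob_0 searching_prob_rec V_def threshold_value_N max_def\<close>)
  also have "(\<Sum>j\<in>{1..N}. (V j - V (j - 1)) * searching_prob p N \<sigma> (j - 1)
      + p * (offer N j - V j) * propose_prob p N \<sigma> j) = 0"
  proof (rule sum.neutral, rule ballI)
    fix j assume j: "j \<in> {1..N}"
    show "(V j - V (j - 1)) * searching_prob p N \<sigma> (j - 1) + p * (offer N j - V j) * propose_prob p N \<sigma> j = 0"
    proof (cases "k \<le> j")
      case True
      then have "V j = F N j" "V (j - 1) = F N (j - 1)" by (simp_all add: V_def max_absorb1)
      then have "V j - V (j - 1) = - (p / real j * (offer N j - V j))"
        using threshold_value_rec[of j N] j N by simp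
      then show ?thesis
        using True j by (simp add: propose_prob_threshold[OF \<sigma> j] del: One_nat_def)
    next
      case False
      then have "V j = V (j - 1)" by (simp add: V_def max_absorb2)
      then show ?thesis using False j by (simp add: propose_prob_threshold[OF \<sigma> j] del: One_nat_def)
    qed
  qed
  finally show ?thesis by (simp add: V_def)
qed

text \<open>The same \<open>V\<close> dominates all strategies, because no defect is positive: from
  \<open>k\<close> on, skipping a candidate gains nothing, and before \<open>k\<close>, proposing to
  one gains nothing.\<close>

lemma expected_payoff_le:
  assumes k: "crossing N k"
  shows "expected_payoff \<alpha> \<beta> \<gamma> p N \<sigma> \<le> F N (k - 1)"
proof -
  have N: "1 \<le> N" and kN: "k \<in> {1..N}" using k by (auto simp: crossing_def)
  define V where "V j = F N (max j (k - 1))" for j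
  have rN: "0 < refusal_ratio p N" using N bounds by (simp add: refusal_ratio_pos)
  have "expected_payoff \<alpha> \<beta> \<gamma> p N \<sigma> = V 0 + (\<Sum>j\<in>{1..N}. (V j - V (j - 1)) * searching_prob p N \<sigma> (j - 1)
      + p * (offer N j - V j) * propose_prob p N \<sigma> j)"
    unfolding expected_payoff_eq[OF bounds(5) less_imp_le[OF bounds(6)]] offer_def
    by (rule verification) (use kN N in \<open>auto simp: searching_prob_0 searching_prob_rec V_def threshold_value_N max_def\<close>)
  also have "(\<Sum>j\<in>{1..N}. (V j - V (j - 1)) * searching_prob p N \<sigma> (j - 1)
      + p * (offer N j - V j) * propose_prob p N \<sigma> j) \<le> 0"
  proof (rule sum_nonpos)
    fix j assume j: "j \<in> {1..N}"
    show "(V j - V (j - 1)) * searching_prob p N \<sigma> (j - 1) + p * (offer N j - V j) * propose_prob p N \<sigma> j \<le> 0"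
    proof (cases "k \<le> j")
      case True
      then have V: "V j = F N j" "V (j - 1) = F N (j - 1)" by (simp_all add: V_def max_absorb1)
      then have "V j - V (j - 1) = - (p / real j * (offer N j - V j))"
        using threshold_value_rec[of j N] j N by simp
      moreover have "0 \<le> margin N j"
        using margin_nonneg_mono[of k j N] True k N by (simp add: crossing_def)
      then have "0 \<le> offer N j - V j"
        unfolding V using j N rN by (subst offer_minus_value) auto
      \<comment> \<open>A nonnegative gain is largest when every candidate gets a proposal, and then
        the recursion gives defect \<open>0\<close>.\<close>
      then have "p * (offer N j - V j) * propose_prob p N \<sigma> j
          \<le> p * (offer N j - V j) * (searching_prob p N \<sigma> (j - 1) / real j)"
        using bounds j by (intro mult_left_mono propose_prob_le mult_nonneg_nonneg) auto
      ultimately show ?thesis by simp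
    next
      case False
      then have V: "V j = V (j - 1)" "V j = F N (k - 1)" by (simp_all add: V_def max_absorb2)
      have "offer N (k - 1) - F N (k - 1) \<le> 0"
      proof -
        have "1 \<le> k - 1" "margin N (k - 1) \<le> 0" using False j k by (auto simp: crossing_def)
        then show ?thesis
          using rN N by (simp only: offer_minus_value) (intro mult_nonneg_nonpos, auto)
      qed
      moreover have "offer N j \<le> offer N (k - 1)"
        using False bounds N by (auto simp: offer_def intro!: mult_left_mono divide_right_mono)
      ultimately have "offer N j - V j \<le> 0" using V by simp
      then have "p * (offer N j - V j) * propose_prob p N \<sigma> j \<le> 0"
        using bounds propose_prob_nonneg[of p N \<sigma> j]
        by (intro mult_nonpos_nonneg mult_nonneg_nonpos) auto
      then show ?thesis using V by simp
    qed
  qed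
  finally show ?thesis by (simp add: V_def)
qed

lemma start_from_eq:
  assumes "1 \<le> N" shows "start_from N (real k / real N) h \<longleftrightarrow> k \<le> length h"
  using assms by (simp add: start_from_def divide_le_cancel)

lemma expected_payoff_start_from:
  assumes "k \<in> {1..N}"
  shows "expected_payoff \<alpha> \<beta> \<gamma> p N (start_from N (real k / real N)) = F N (k - 1)"
  using assms by (intro expected_payoff_threshold) (simp_all add: start_from_eq)

lemma crossing_optimal:
  assumes "crossing N k"
  shows "optimal_strategy \<alpha> \<beta> \<gamma> p N (start_from N (real k / real N))"
  using expected_payoff_le[OF assms] expected_payoff_start_from[of k N] assms
  by (simp add: optimal_strategy_def crossing_def)

lemma optimal_value_crossing:
  assumes "crossing N k"
  shows "optimal_value \<alpha> \<beta> \<gamma> p N = F N (k - 1)"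
  unfolding optimal_value_def
proof (rule cSup_eq_maximum)
  show "F N (k - 1) \<in> range (expected_payoff \<alpha> \<beta> \<gamma> p N)"
    using expected_payoff_start_from[of k N] assms by (metis crossing_def rangeI)
qed (use expected_payoff_le[OF assms] in auto)

text \<open>Comparison with the neighbouring thresholds \<open>k + 1\<close> and
  \<open>k - 1\<close> is enough: each difference of payoffs is a multiple of a margin, by a factor
  that is positive because \<open>0 < p\<close>.\<close>

lemma optimal_imp_crossing:
  assumes p: "0 < p" and k: "k \<in> {1..N}"
    and opt: "optimal_strategy \<alpha> \<beta> \<gamma> p N (start_from N (real k / real N))"
  shows "crossing N k"
proof -
  have N: "1 \<le> N" using k by simp
  have rN: "0 < p / (real N * refusal_ratio p N)" using N p bounds by (simp add: refusal_ratio_pos)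
  have le: "F N (j - 1) \<le> F N (k - 1)" if "j \<in> {1..N}" for j
    using opt expected_payoff_start_from[OF that] expected_payoff_start_from[OF k]
    unfolding optimal_strategy_def by metis
  \<comment> \<open>The threshold \<open>N\<close> has no right neighbour in range, but there the
    margin is nonnegative anyway.\<close>
  have "0 \<le> margin N k"
  proof (cases "k = N")
    case True
    then show ?thesis using margin_N_nonneg N by simp
  next
    case False
    then have "0 \<le> p / (real N * refusal_ratio p N) * margin N k"
      using le[of "Suc k"] k N by (subst threshold_value_step[symmetric]) auto
    then show ?thesis using rN by (simp only: zero_le_mult_iff) auto
  qed
  moreover have "margin N (k - 1) \<le> 0" if "2 \<le> k"
  proof -
    have "p / (real N * refusal_ratio p N) * margin N (k - 1) \<le> 0"
    proof -
      have "k - 1 \<in> {1..N}" using that k by auto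
      with le[OF this] show ?thesis using N by (subst threshold_value_step[symmetric]) auto
    qed
    then show ?thesis using rN by (simp only: mult_le_0_iff) auto
  qed
  ultimately show ?thesis using k by (simp add: crossing_def)
qed

section \<open>The moment \<open>t_star\<close> and the passage to the limit\<close>

lemma t_star_eq: "t_star \<alpha> \<beta> \<gamma> p = max 0 (C / A) powr (1 / (1 - p))"
proof -
  have A: "A * (1 - p) = \<alpha> + \<beta>" using bounds by (simp add: A_def)
  have "C * (1 - p) = p * \<alpha> + \<beta> - (1 - p) * \<gamma>"
  proof -
    have "C * (1 - p) = (\<beta> - \<gamma>) * (1 - p) + p * (A * (1 - p))" by (simp add: C_def algebra_simps)
    then show ?thesis unfolding A by (simp add: algebra_simps)
  qed
  then have "C / A = (p * \<alpha> + \<beta> - (1 - p) * \<gamma>) / (\<alpha> + \<beta>)"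
    unfolding A[symmetric] using bounds by (simp flip: \<open>C * (1 - p) = _\<close>)
  then show ?thesis by (simp add: t_star_def)
qed

lemma t_star_le_1: "t_star \<alpha> \<beta> \<gamma> p \<le> 1"
proof -
  have "C / A \<le> 1"
    using A_minus_C A_pos bounds by simp
  then show ?thesis unfolding t_star_eq using bounds by (intro powr_le1) auto
qed

text \<open>For \<open>C \<le> 0\<close> the margin is positive at every positive index, so the
  condition at \<open>k - 1\<close> can never hold.\<close>

lemma crossing_nonpos:
  assumes "C \<le> 0" "crossing N k"
  shows "k = 1"
proof (rule ccontr)
  assume "k \<noteq> 1"
  then have k: "2 \<le> k" "1 \<le> N" "margin N (k - 1) \<le> 0" using assms by (auto simp: crossing_def)
  have "0 < A * refusal_ratio p N" using A_pos refusal_ratio_pos[of p N] k bounds by (intro mult_pos_pos) auto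
  moreover have "C * refusal_ratio p (k - 1) \<le> 0"
    using assms refusal_ratio_pos[of p "k - 1"] k bounds by (intro mult_nonpos_nonneg) auto
  ultimately show False using k by (simp add: margin_def)
qed

text \<open>For \<open>C > 0\<close> this is \<open>threshold_asymp\<close> with
  \<open>x = C / A\<close>. Otherwise the crossing stays at \<open>1\<close>, in accordance with the
  moment \<open>0\<close>.\<close>

lemma crossing_tendsto:
  assumes k: "\<And>N. 1 \<le> N \<Longrightarrow> crossing N (k N)"
  shows "(\<lambda>N. real (k N) / real N) \<longlonglongrightarrow> t_star \<alpha> \<beta> \<gamma> p"
proof (cases "C \<le> 0")
  case True
  have ev: "\<forall>\<^sub>F N in sequentially. 1 / real N = real (k N) / real N"
    by (rule eventually_sequentiallyI[of 1]) (simp add: crossing_nonpos[OF True k])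
  have "C / A \<le> 0" using True A_pos by (intro divide_nonpos_nonneg) auto
  \<comment> \<open>The truncation leaves the base \<open>0\<close>, and \<open>0 powr a\<close> is
    \<open>0\<close>.\<close>
  then have "t_star \<alpha> \<beta> \<gamma> p = 0" by (simp add: t_star_eq max_absorb1)
  then show ?thesis
    using Lim_transform_eventually[OF lim_1_over_n[where 'a = real] ev] by simp
next
  case False
  have pos: "0 < C / A" using False A_pos by (intro divide_pos_pos) auto
  have "(\<lambda>N. real (k N) / real N) \<longlonglongrightarrow> (C / A) powr (1 / (1 - p))"
  proof (rule threshold_asymp[OF bounds(6) pos])
    fix N :: nat assume N: "1 \<le> N"
    show "1 \<le> k N" using k[OF N] by (simp add: crossing_def)
    have "C * refusal_ratio p (k N) \<le> A * refusal_ratio p N"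
      using k[OF N] by (simp add: crossing_def margin_def)
    then show "C / A * refusal_ratio p (k N) \<le> refusal_ratio p N"
      using A_pos by (simp only: times_divide_eq_left pos_divide_le_eq) (simp only: mult.commute)
    assume "2 \<le> k N"
    then have "A * refusal_ratio p N \<le> C * refusal_ratio p (k N - 1)"
      using k[OF N] by (simp add: crossing_def margin_def)
    then show "refusal_ratio p N \<le> C / A * refusal_ratio p (k N - 1)"
      using A_pos by (simp only: times_divide_eq_left pos_le_divide_eq) (simp only: mult.commute)
  qed
  then show ?thesis using pos by (simp add: t_star_eq max_absorb2)
qed

text \<open>The limit depends on \<open>t\<close> only, so threshold sequences with a common
  positive limit have the same limiting payoff. The shift by one vanishes after division by
  \<open>N\<close>.\<close>

lemma threshold_value_tendsto:
  assumes t: "0 < t" and k: "\<And>N. 1 \<le> N \<Longrightarrow> 1 \<le> k N" "(\<lambda>N. real (k N) / real N) \<longlonglongrightarrow> t"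
  shows "(\<lambda>N. F N (k N - 1)) \<longlonglongrightarrow> - \<beta> - p * A * t + C * t powr p"
proof -
  have "(\<lambda>N. real (k N) / real N - 1 / real N) \<longlonglongrightarrow> t - 0"
    by (intro tendsto_diff k lim_1_over_n)
  moreover have "\<forall>\<^sub>F N in sequentially. real (k N) / real N - 1 / real N = real (k N - 1) / real N"
    using k(1) by (intro eventually_sequentiallyI[of 1]) (simp add: diff_divide_distrib of_nat_diff)
  ultimately have m: "(\<lambda>N. real (k N - 1) / real N) \<longlonglongrightarrow> t" by (simp add: tendsto_cong)
  show ?thesis
    unfolding threshold_value_def
    by (intro tendsto_intros m refusal_growth_quotient_tendsto[OF bounds(6) t m])
qed

text \<open>The moment in integer form: the first index not below \<open>t_star * N\<close>, raised
  to \<open>1\<close> when the moment is \<open>0\<close>.\<close>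

lemma start_from_t_star:
  assumes "1 \<le> N"
  defines "k \<equiv> max 1 (nat \<lceil>t_star \<alpha> \<beta> \<gamma> p * real N\<rceil>)"
  shows "k \<in> {1..N}" "expected_payoff \<alpha> \<beta> \<gamma> p N (start_from N (t_star \<alpha> \<beta> \<gamma> p)) = F N (k - 1)"
proof -
  let ?t = "t_star \<alpha> \<beta> \<gamma> p"
  have "?t * real N \<le> 1 * real N" using t_star_le_1 by (intro mult_right_mono) auto
  then show kN: "k \<in> {1..N}" using assms by (simp add: k_def nat_le_iff ceiling_le_iff)
  show "expected_payoff \<alpha> \<beta> \<gamma> p N (start_from N ?t) = F N (k - 1)"
  proof (rule expected_payoff_threshold[OF kN])
    fix h :: "nat list" assume "h \<noteq> []"
    then have "1 \<le> length h" by (cases h) auto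
    then have "k \<le> length h \<longleftrightarrow> ?t * real N \<le> real (length h)"
      by (simp add: k_def nat_le_iff ceiling_le_iff)
    then show "start_from N ?t h \<longleftrightarrow> k \<le> length h"
      using assms by (simp add: start_from_def pos_le_divide_eq)
  qed
qed

text \<open>An optimal threshold and the one read off \<open>t_star\<close> have the same limiting
  position, hence the same limiting value. For \<open>C \<le> 0\<close> the position is
  \<open>0\<close>, but then both thresholds equal \<open>1\<close> and the gap is exactly
  \<open>0\<close>.\<close>

lemma optimality_gap_tendsto:
  "(\<lambda>N. optimal_value \<alpha> \<beta> \<gamma> p N
      - expected_payoff \<alpha> \<beta> \<gamma> p N (start_from N (t_star \<alpha> \<beta> \<gamma> p))) \<longlonglongrightarrow> 0"
proof -
  let ?t = "t_star \<alpha> \<beta> \<gamma> p"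
  define k where "k N = (SOME k. crossing N k)" for N
  define k' where "k' N = max 1 (nat \<lceil>?t * real N\<rceil>)" for N
  have k: "crossing N (k N)" if "1 \<le> N" for N
    unfolding k_def by (rule someI_ex[OF crossing_exists[OF that]])
  have gap: "\<forall>\<^sub>F N in sequentially. F N (k N - 1) - F N (k' N - 1)
      = optimal_value \<alpha> \<beta> \<gamma> p N - expected_payoff \<alpha> \<beta> \<gamma> p N (start_from N ?t)"
    by (rule eventually_sequentiallyI[of 1])
      (simp only: optimal_value_crossing[OF k] start_from_t_star k'_def)
  show ?thesis
  proof (cases "C \<le> 0")
    case True
    have "C / A \<le> 0" using True A_pos by (intro divide_nonpos_nonneg) auto
    then have "?t = 0" by (simp add: t_star_eq max_absorb1)
    then have "k' N = 1" for N by (simp add: k'_def)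
    then have "\<forall>\<^sub>F N in sequentially. 0 = F N (k N - 1) - F N (k' N - 1)"
      by (intro eventually_sequentiallyI[of 1]) (simp add: crossing_nonpos[OF True k])
    then have "(\<lambda>N. F N (k N - 1) - F N (k' N - 1)) \<longlonglongrightarrow> 0"
      by (subst tendsto_cong[symmetric]) auto
    then show ?thesis using tendsto_cong[OF gap] by simp
  next
    case False
    have "0 < C / A" using False A_pos by (intro divide_pos_pos) auto
    then have t: "0 < ?t" using A_pos False by (simp add: t_star_eq max_absorb2)
    have k'lim: "(\<lambda>N. real (k' N) / real N) \<longlonglongrightarrow> ?t"
    proof (rule real_tendsto_sandwich[OF _ _ tendsto_const])
      show "\<forall>\<^sub>F N in sequentially. ?t \<le> real (k' N) / real N"
        by (rule eventually_sequentiallyI[of 1])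
          (simp add: k'_def pos_le_divide_eq le_max_iff_disj of_nat_max real_nat_ceiling_ge)
      show "\<forall>\<^sub>F N in sequentially. real (k' N) / real N \<le> ?t + 1 / real N"
      proof (rule eventually_sequentiallyI[of 1])
        fix N :: nat assume N: "1 \<le> N"
        then have "0 < ?t * real N" using t by simp
        then have "real (k' N) \<le> ?t * real N + 1"
          by (auto simp: k'_def max_def)
        then show "real (k' N) / real N \<le> ?t + 1 / real N" using N by (simp add: field_simps)
      qed
      show "(\<lambda>N. ?t + 1 / real N) \<longlonglongrightarrow> ?t"
        using tendsto_add[OF tendsto_const lim_1_over_n] by simp
    qed
    have "(\<lambda>N. F N (k N - 1) - F N (k' N - 1)) \<longlonglongrightarrow> 0"
      using tendsto_diff[OF threshold_value_tendsto[OF t _ crossing_tendsto[OF k]]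
          threshold_value_tendsto[OF t _ k'lim]] k
      by (simp add: k'_def crossing_def)
    then show ?thesis using tendsto_cong[OF gap] by simp
  qed
qed

end

text \<open>For \<open>p = 0\<close> every strategy has payoff \<open>- \<gamma>\<close> and every
  threshold is optimal, which is why convergence of optimal thresholds is claimed for
  \<open>0 < p\<close>.\<close>

theorem corollary2p6:
  fixes \<alpha> \<beta> \<gamma> p :: real
  assumes "\<alpha> \<in> {0..1}" and "\<beta> \<in> {0..1}" and "\<gamma> \<in> {0..1}"
    and "0 < \<alpha> + \<beta>"
    and "0 \<le> p" and "p < 1"
  shows "(\<forall>N\<ge>1. \<exists>k\<in>{1..N}.
            optimal_strategy \<alpha> \<beta> \<gamma> p N (start_from N (real k / real N)))
       \<and> (0 < p \<longrightarrow>
            (\<forall>k :: nat \<Rightarrow> nat.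
              (\<forall>N\<ge>1. k N \<in> {1..N} \<and>
                 optimal_strategy \<alpha> \<beta> \<gamma> p N (start_from N (real (k N) / real N))) \<longrightarrow>
              (\<lambda>N. real (k N) / real N) \<longlonglongrightarrow> t_star \<alpha> \<beta> \<gamma> p))
       \<and> (\<lambda>N. optimal_value \<alpha> \<beta> \<gamma> p N
               - expected_payoff \<alpha> \<beta> \<gamma> p N (start_from N (t_star \<alpha> \<beta> \<gamma> p))) \<longlonglongrightarrow> 0"
proof (intro conjI allI impI)
  interpret uncertain_employment \<alpha> \<beta> \<gamma> p by unfold_locales (use assms in auto)
  show "\<exists>k\<in>{1..N}. optimal_strategy \<alpha> \<beta> \<gamma> p N (start_from N (real k / real N))" if N: "1 \<le> N" for N
    using crossing_exists[OF N] crossing_optimal crossing_def by metis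
  show "(\<lambda>N. real (k N) / real N) \<longlonglongrightarrow> t_star \<alpha> \<beta> \<gamma> p"
    if "0 < p" "\<forall>N\<ge>1. k N \<in> {1..N} \<and>
         optimal_strategy \<alpha> \<beta> \<gamma> p N (start_from N (real (k N) / real N))" for k :: "nat \<Rightarrow> nat"
    using that by (intro crossing_tendsto optimal_imp_crossing) auto
  show "(\<lambda>N. optimal_value \<alpha> \<beta> \<gamma> p N
      - expected_payoff \<alpha> \<beta> \<gamma> p N (start_from N (t_star \<alpha> \<beta> \<gamma> p))) \<longlonglongrightarrow> 0"
    by (rule optimality_gap_tendsto)
qed

end
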